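(* Let $G$ be either the De Bruijn digraph $B(d,D)$ or the Kautz digraph $K(d,D)$, with vertex set $V$. Let $v\in V$ and let $0\le i\le D$. Then for every vertex $w\in V$ there exists at most one integer $j_0$, $i\le j_0\le D$, such that $S_{i}^\star(v) \cap S_{j_0}^{\star}(w)\ne \emptyset$. In particular, if $w\in S_1(v)$, then (1) either there exists a unique integer $j_0$, $i\le j_0\le D$, such that the intersection $S_{i}^\star(v) \cap S_{j_0}^{\star}(w)$ is nonempty, and so $$S_i^\star(v)=\left(S_{i}^\star(v) \cap S_{i-1}^{\star}(w)\right)\cup \left(S_{i}^\star(v) \cap S_{j_0}^{\star}(w)\right)\quad \text{if } S_{i}^\star(v) \cap S_{i-1}^{\star}(w)\ne\emptyset,$$ $$S_i^\star(v)=S_{i}^\star(v) \cap S_{j_0}^{\star}(w)\quad \text{if } S_{i}^\star(v) \cap S_{i-1}^{\star}(w)=\emptyset;$$ (2) or, for every integer $j$, $i\le j\le D$, the intersection $S_{i}^\star(v) \cap S_{j}^{\star}(w)$ is empty, and so $S_i^\star(v)= S_{i}^\star(v) \cap S_{i-1}^{\star}(w)$.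
   Context: Let $d\ge 2$ and $D\ge 1$ be integers. The De Bruijn digraph $B(d,D)$ has as vertices all words $v=v_1v_2\cdots v_D$ over an alphabet $A$ with $|A|=d$; $v$ is adjacent to the $d$ vertices $v_2\cdots v_D v_{D+1}$, $v_{D+1}\in A$ (loops occur). The Kautz digraph $K(d,D)$ has as vertices all words $v=v_1v_2\cdots v_D$ over an alphabet $A$ with $|A|=d+1$ such that $v_k\ne v_{k+1}$ for $1\le k<D$; $v$ is adjacent to the $d$ vertices $v_2\cdots v_Dv_{D+1}$ with $v_{D+1}\in A$, $v_{D+1}\ne v_D$. Both are $d$-regular of diameter $D$. For $v\in V$ and $i\ge 0$, $S_i(v)$ is the set of vertices $u$ for which there is a walk of length exactly $i$ from $v$ to $u$ (so $S_1(v)$ is the set of vertices adjacent from $v$), and $S_i^\star(v)$ is the set of vertices at (directed) distance exactly $i$ from $v$. Convention: $S_{-1}^\star(w)=\emptyset$. *)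

theory Defs
  imports "Graph_Theory.Graph_Theory"
begin

definition de_bruijn :: "'a set \<Rightarrow> nat \<Rightarrow> 'a list pair_pre_digraph" where
  "de_bruijn A D =
    (let V = {v. length v = D \<and> set v \<subseteq> A}
     in \<lparr> pverts = V, parcs = {(v, tl v @ [a]) | v a. v \<in> V \<and> a \<in> A} \<rparr>)"

definition kautz :: "'a set \<Rightarrow> nat \<Rightarrow> 'a list pair_pre_digraph" where
  "kautz A D =
    (let V = {v. length v = D \<and> set v \<subseteq> A \<and> distinct_adj v}
     in \<lparr> pverts = V, parcs = {(v, tl v @ [a]) | v a. v \<in> V \<and> a \<in> A \<and> a \<noteq> last v} \<rparr>)"

text \<open>The definition of \<open>wf_digraph.\<mu>\<close> is only available for well-formed digraphs. The two
  families are well-formed for positive word length; for length \<open>0\<close> they are not, since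
  the arcs then leave the vertex set.\<close>

lemma wf_digraph_de_bruijn: "D \<ge> 1 \<Longrightarrow> wf_digraph (de_bruijn A D)"
proof
  fix e assume D: "D \<ge> 1" and e: "e \<in> arcs (de_bruijn A D)"
  then obtain v a where va: "e = (v, tl v @ [a])" "length v = D" "set v \<subseteq> A" "a \<in> A"
    by (auto simp: de_bruijn_def Let_def)
  then show "tail (de_bruijn A D) e \<in> verts (de_bruijn A D)"
    by (simp add: de_bruijn_def Let_def)
  show "head (de_bruijn A D) e \<in> verts (de_bruijn A D)"
    using va D by (cases v) (auto simp: de_bruijn_def Let_def)
qed

lemma wf_digraph_kautz: "D \<ge> 1 \<Longrightarrow> wf_digraph (kautz A D)"
proof
  fix e assume D: "D \<ge> 1" and e: "e \<in> arcs (kautz A D)"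
  then obtain v a where va: "e = (v, tl v @ [a])" "length v = D" "set v \<subseteq> A"
      "distinct_adj v" "a \<in> A" "a \<noteq> last v"
    by (auto simp: kautz_def Let_def)
  then show "tail (kautz A D) e \<in> verts (kautz A D)"
    by (simp add: kautz_def Let_def)
  show "head (kautz A D) e \<in> verts (kautz A D)"
    using va D by (cases v) (auto simp: kautz_def Let_def distinct_adj_append_iff
        distinct_adj_Cons split: if_splits)
qed

definition walk_sphere :: "('a, 'b) pre_digraph \<Rightarrow> nat \<Rightarrow> 'a \<Rightarrow> 'a set" where
  "walk_sphere G i v = {u. \<exists>p. pre_digraph.awalk G v p u \<and> length p = i}"

text \<open>The directed distance is the library's shortest-path weight for unit arc weights, which is
  \<open>\<infinity>\<close> for unreachable vertices. The radius is an integer, since the radius \<open>-1\<close> occurs.\<close>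

definition dist_sphere :: "('a, 'b) pre_digraph \<Rightarrow> int \<Rightarrow> 'a \<Rightarrow> 'a set" where
  "dist_sphere G i v = {u \<in> verts G. wf_digraph.\<mu> G (\<lambda>_. 1) v u = ereal (of_int i)}"

lemma dist_sphere_negative:
  assumes "wf_digraph G" "i < 0"
  shows "dist_sphere G i v = {}"
proof -
  interpret wf_digraph G by fact
  have cost: "awalk_cost (\<lambda>_. 1) p \<ge> 0" for p
    unfolding awalk_cost_def by (rule sum_list_nonneg) auto
  have "0 \<le> \<mu> (\<lambda>_. 1) v u" for u
    unfolding \<mu>_def by (rule INF_greatest) (simp add: cost)
  moreover have "ereal (of_int i) < 0"
    using assms(2) by simp
  ultimately have "\<mu> (\<lambda>_. 1) v u \<noteq> ereal (of_int i)" for u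
    by (metis not_le)
  then show ?thesis
    by (simp add: dist_sphere_def)
qed

end

theory Submission
  imports Defs
begin

text \<open>
  Walks of length \<open>k \<le> D\<close> between words of length \<open>D\<close> are governed by overlaps. Each arc
  deletes the first letter and appends a new last one, so a walk of length \<open>k\<close> from \<open>w\<close> to \<open>u\<close>
  forces the last \<open>D - k\<close> letters of \<open>w\<close> to be the first \<open>D - k\<close> letters of \<open>u\<close>
  (\<open>walk_imp_overlap\<close>); conversely such an overlap yields a walk of length at most \<open>k\<close>
  (\<open>overlap_imp_walk\<close>). The converse would fail for walks of length exactly \<open>k\<close>: in the Kautz
  digraph a walk of length \<open>D\<close> from \<open>w\<close> to \<open>u\<close> needs the last letter of \<open>w\<close> to differ from the
  first letter of \<open>u\<close>. But if these letters agree, then they are an overlap of length one, which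
  gives a walk of length \<open>D - 1\<close>.

  Now all words at distance \<open>i\<close> from \<open>v\<close> share their first \<open>D - i\<close> letters, namely the last
  \<open>D - i\<close> letters of \<open>v\<close>. For \<open>j \<ge> i\<close>, whether a word \<open>u\<close> overlaps with \<open>w\<close> in \<open>D - j\<close> letters
  depends only on the first \<open>D - j \<le> D - i\<close> letters of \<open>u\<close>, hence has the same answer for all
  words of the sphere around \<open>v\<close>. If one of them is at distance \<open>j\<close> from \<open>w\<close>, then all of them
  are at distance at most \<open>j\<close> (\<open>sphere_within_distance\<close>), so two values \<open>j \<ge> i\<close> cannot both
  occur. When \<open>w\<close> is adjacent from \<open>v\<close>, the triangle inequality leaves \<open>i - 1\<close> as the only
  further distance that occurs.
\<close>

section \<open>Distance as least walk length\<close>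

text \<open>The infimum that defines the shortest-path weight is attained, because it ranges over walk
  lengths. All later arguments can therefore speak of walks instead of extended reals.\<close>

lemma mem_dist_sphere_iff:
  assumes "wf_digraph G"
  shows "u \<in> dist_sphere G (int n) w \<longleftrightarrow>
    u \<in> walk_sphere G n w \<and> (\<forall>m. u \<in> walk_sphere G m w \<longrightarrow> n \<le> m)"
proof -
  interpret wf_digraph G by fact
  have "awalk_cost (\<lambda>_. 1) p = real (length p)" for p
    by (induction p) auto
  then have mu: "\<mu> (\<lambda>_. 1) w u = (INF p\<in>{p. awalk w p u}. ereal (real (length p)))"
    by (simp add: \<mu>_def)
  show ?thesis
  proof
    assume u: "u \<in> dist_sphere G (int n) w"
    then have eq: "\<mu> (\<lambda>_. 1) w u = ereal (real n)"
      by (simp add: dist_sphere_def)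
    have le: "n \<le> m" if m: "u \<in> walk_sphere G m w" for m
    proof -
      obtain p where "awalk w p u" "length p = m"
        using m by (auto simp: walk_sphere_def)
      then have "\<mu> (\<lambda>_. 1) w u \<le> ereal (real m)"
        unfolding mu by (auto intro!: INF_lower2)
      then show ?thesis by (simp add: eq)
    qed
    have "\<mu> (\<lambda>_. 1) w u < ereal (real (Suc n))"
      by (simp add: eq)
    then obtain p where p: "awalk w p u" "length p < Suc n"
      unfolding mu INF_less_iff by auto
    then have "u \<in> walk_sphere G (length p) w"
      by (auto simp: walk_sphere_def)
    moreover from this have "length p = n"
      using le p(2) by fastforce
    ultimately show "u \<in> walk_sphere G n w \<and> (\<forall>m. u \<in> walk_sphere G m w \<longrightarrow> n \<le> m)"
      using le by blast
  next
    assume *: "u \<in> walk_sphere G n w \<and> (\<forall>m. u \<in> walk_sphere G m w \<longrightarrow> n \<le> m)"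
    then obtain p where p: "awalk w p u" "length p = n"
      by (auto simp: walk_sphere_def)
    have "\<mu> (\<lambda>_. 1) w u = ereal (real n)"
      unfolding mu
    proof (rule antisym)
      show "(INF p\<in>{p. awalk w p u}. ereal (real (length p))) \<le> ereal (real n)"
        using p by (auto intro!: INF_lower2)
      show "ereal (real n) \<le> (INF p\<in>{p. awalk w p u}. ereal (real (length p)))"
        using * by (auto intro!: INF_greatest simp: walk_sphere_def)
    qed
    then show "u \<in> dist_sphere G (int n) w"
      using p(1) by (auto simp: dist_sphere_def)
  qed
qed

lemma walk_sphere_imp_dist_sphere:
  assumes "wf_digraph G" and "u \<in> walk_sphere G n w"
  obtains m where "m \<le> n" and "u \<in> dist_sphere G (int m) w"
proof
  let ?m = "LEAST m. u \<in> walk_sphere G m w"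
  show "?m \<le> n"
    using assms(2) by (rule Least_le)
  show "u \<in> dist_sphere G (int ?m) w"
    using assms by (auto simp: mem_dist_sphere_iff intro: LeastI Least_le)
qed

lemma walk_sphere_Suc_iff:
  assumes "wf_digraph G"
  shows "u \<in> walk_sphere G (Suc n) w \<longleftrightarrow>
    (\<exists>e\<in>arcs G. tail G e = w \<and> u \<in> walk_sphere G n (head G e))"
proof -
  interpret wf_digraph G by fact
  have "u \<in> walk_sphere G (Suc n) w \<longleftrightarrow> (\<exists>e p. awalk w (e # p) u \<and> length p = n)"
    by (auto simp: walk_sphere_def length_Suc_conv)
  then show ?thesis
    by (auto simp: walk_sphere_def awalk_Cons_iff)
qed

lemma walk_sphere_0_iff: "u \<in> walk_sphere G 0 w \<longleftrightarrow> u = w \<and> w \<in> verts G"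
  by (auto simp: walk_sphere_def pre_digraph.awalk_def pre_digraph.cas.simps)

section \<open>De Bruijn and Kautz digraphs as word digraphs\<close>

text \<open>The De Bruijn and the Kautz digraph share one description: consecutive letters of a word are
  related by \<open>R\<close>, where \<open>R\<close> is the full relation or \<open>(\<noteq>)\<close>. The only common property of these
  relations that matters is that unrelated letters are equal.\<close>

definition word_digraph :: "('a \<Rightarrow> 'a \<Rightarrow> bool) \<Rightarrow> 'a set \<Rightarrow> nat \<Rightarrow> 'a list pair_pre_digraph" where
  "word_digraph R A D =
    (let V = {v. length v = D \<and> set v \<subseteq> A \<and> successively R v}
     in \<lparr> pverts = V, parcs = {(v, tl v @ [a]) | v a. v \<in> V \<and> a \<in> A \<and> R (last v) a} \<rparr>)"

lemma de_bruijn_eq_word_digraph: "de_bruijn A D = word_digraph (\<lambda>_ _. True) A D"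
proof -
  have "successively (\<lambda>_ _. True) v" for v :: "'a list"
    by (induction v rule: induct_list012) auto
  then show ?thesis
    by (simp add: de_bruijn_def word_digraph_def)
qed

lemma kautz_eq_word_digraph: "kautz A D = word_digraph (\<noteq>) A D"
  by (simp add: kautz_def word_digraph_def distinct_adj_def eq_commute)

lemma verts_word_digraph:
  "v \<in> pverts (word_digraph R A D) \<longleftrightarrow> length v = D \<and> set v \<subseteq> A \<and> successively R v"
  by (simp add: word_digraph_def Let_def)

lemma arcs_word_digraph:
  "e \<in> parcs (word_digraph R A D) \<longleftrightarrow>
    (\<exists>v a. e = (v, tl v @ [a]) \<and> v \<in> pverts (word_digraph R A D) \<and> a \<in> A \<and> R (last v) a)"
  by (simp add: word_digraph_def Let_def)

section \<open>Walks and overlaps\<close>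

context
  fixes R :: "'a \<Rightarrow> 'a \<Rightarrow> bool" and A :: "'a set" and D :: nat
    and G :: "'a list pair_pre_digraph"
  defines "G \<equiv> word_digraph R A D"
  assumes wf: "wf_digraph G"
begin

lemma walk_imp_overlap:
  assumes "u \<in> walk_sphere G k w" and "k \<le> D"
  shows "drop k w = take (D - k) u"
  using assms
proof (induction k arbitrary: w)
  case 0
  then show ?case
    by (simp add: walk_sphere_0_iff G_def verts_word_digraph)
next
  case (Suc k)
  then obtain e where "e \<in> parcs G" "fst e = w" "u \<in> walk_sphere G k (snd e)"
    by (auto simp: walk_sphere_Suc_iff[OF wf])
  then obtain a where w: "w \<in> pverts G" and u: "u \<in> walk_sphere G k (tl w @ [a])"
    by (auto simp: G_def arcs_word_digraph)
  have len: "length w = D"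
    using w by (simp add: G_def verts_word_digraph)
  have "drop k (tl w @ [a]) = take (D - k) u"
    using Suc.IH[OF u] Suc.prems by simp
  moreover have "drop k (tl w @ [a]) = drop (Suc k) w @ [a]"
    using Suc.prems(2) len by (simp add: drop_Suc)
  ultimately have "drop (Suc k) w @ [a] = take (D - k) u"
    by simp
  then have "take (D - Suc k) (drop (Suc k) w @ [a]) = take (D - Suc k) u"
    by (simp add: min_def)
  then show ?case
    using len by simp
qed

lemma walk_by_appending:
  assumes "w \<in> pverts G" and "set zs \<subseteq> A" and "successively R (w @ zs)" and "D \<ge> 1"
  shows "drop (length zs) (w @ zs) \<in> walk_sphere G (length zs) w"
  using assms
proof (induction zs arbitrary: w)
  case Nil
  then show ?case
    by (simp add: walk_sphere_0_iff)
next
  case (Cons a zs)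
  have ne: "w \<noteq> []" and R: "R (last w) a"
    using Cons.prems by (auto simp: G_def verts_word_digraph successively_append_iff)
  have arc: "(w, tl w @ [a]) \<in> parcs G"
    using Cons.prems R by (auto simp: G_def arcs_word_digraph)
  then have "tl w @ [a] \<in> pverts G"
    using wf_digraph.head_in_verts[OF wf, of "(w, tl w @ [a])"] by simp
  moreover have "successively R ((tl w @ [a]) @ zs)"
    using Cons.prems(3) ne by (cases w) (auto simp: successively_Cons)
  ultimately have "drop (length zs) ((tl w @ [a]) @ zs) \<in> walk_sphere G (length zs) (tl w @ [a])"
    using Cons.prems by (intro Cons.IH) auto
  moreover have "drop (length zs) ((tl w @ [a]) @ zs) = drop (length (a # zs)) (w @ a # zs)"
    using ne by (cases w) auto
  ultimately have "drop (length (a # zs)) (w @ a # zs) \<in> walk_sphere G (length zs) (tl w @ [a])"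
    by simp
  then show ?case
    unfolding list.size add_Suc_right add_0_right walk_sphere_Suc_iff[OF wf]
    by (intro bexI[of _ "(w, tl w @ [a])"]) (simp_all add: arc)
qed

context
  assumes related_or_eq: "\<forall>x y. R x y \<or> x = y"
    and D: "D \<ge> 1"
begin

text \<open>The overlapping words merge into one word, and the walk reads off its factors of length
  \<open>D\<close>. This needs the merged word to satisfy \<open>R\<close> where the two words meet. For a nonempty overlap
  every pair of consecutive letters lies inside one of the words; for an empty one, unrelated
  letters are equal and so form an overlap of length one.\<close>

lemma overlap_imp_walk:
  assumes w: "w \<in> pverts G" and u: "u \<in> pverts G"
    and k: "k \<le> D" and overlap: "drop k w = take (D - k) u"
  obtains m where "m \<le> k" and "u \<in> walk_sphere G m w"
proof -
  have lens: "length w = D" "length u = D" and R: "successively R w" "successively R u"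
    and A: "set u \<subseteq> A"
    using w u by (auto simp: G_def verts_word_digraph)
  have walk: "u \<in> walk_sphere G l w"
    if l: "l \<le> D" "drop l w = take (D - l) u" and meet: "l < D \<or> R (last w) (hd u)" for l
  proof -
    let ?zs = "drop (D - l) u"
    have "take l w @ u = take l w @ take (D - l) u @ ?zs"
      by simp
    also have "\<dots> = w @ ?zs"
      unfolding l(2)[symmetric] by (simp flip: append_assoc)
    finally have merge: "w @ ?zs = take l w @ u" ..
    have "R (last (take l w)) (hd u)" if ne: "take l w \<noteq> []"
    proof (cases "l < D")
      case True
      \<comment> \<open>the first letter of \<open>u\<close> is the first letter of the overlap, hence a letter of \<open>w\<close>\<close>
      have "hd u = hd (drop l w)"
        using True l(2) lens by (simp add: hd_take)
      moreover have "successively R (take l w @ drop l w)" and "drop l w \<noteq> []"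
        using R True lens by simp_all
      ultimately show ?thesis
        using ne unfolding successively_append_iff by auto
    next
      case False
      then show ?thesis
        using meet lens by simp
    qed
    moreover have "successively R (take l w)"
      using R(1) by (metis append_take_drop_id successively_append_iff)
    ultimately have "successively R (w @ ?zs)"
      unfolding merge successively_append_iff using R(2) by auto
    then have "drop (length ?zs) (w @ ?zs) \<in> walk_sphere G (length ?zs) w"
      using A by (intro walk_by_appending w D) (auto dest: in_set_dropD)
    moreover have "drop (length ?zs) (w @ ?zs) = u"
      unfolding merge using lens l(1) by simp
    ultimately show ?thesis
      using lens l(1) by simp
  qed
  show ?thesis
  proof (cases "k < D \<or> R (last w) (hd u)")
    case True
    then show ?thesis
      using walk[OF k overlap] that by blast
  next
    case False
    then have kD: "k = D" and meet: "last w = hd u"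
      using k related_or_eq by auto
    obtain ys x where ys: "w = ys @ [x]"
      using lens D by (cases w rule: rev_cases) auto
    obtain zs where "u = x # zs"
      using lens D meet ys by (cases u) auto
    then have "drop (D - 1) w = take (D - (D - 1)) u"
      using lens ys by auto
    then have "u \<in> walk_sphere G (D - 1) w"
      using D by (intro walk) auto
    then show ?thesis
      using that kD by (metis diff_le_self)
  qed
qed

lemma walk_to_vertex:
  assumes "w \<in> pverts G" and "u \<in> pverts G"
  obtains m where "m \<le> D" and "u \<in> walk_sphere G m w"
proof -
  have "drop D w = take (D - D) u"
    using assms(1) by (simp add: G_def verts_word_digraph)
  then show ?thesis
    using overlap_imp_walk[OF assms order_refl] that by blast
qed

section \<open>Intersections of spheres\<close>

text \<open>Membership of \<open>u\<close> in the ball of radius \<open>j \<ge> i\<close> around \<open>w\<close> is decided by the first \<open>D - j\<close>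
  letters of \<open>u\<close>, which are constant on the sphere of radius \<open>i\<close> around \<open>v\<close>.\<close>

lemma sphere_within_distance:
  assumes "w \<in> pverts G" and "i \<le> j" and "j \<le> D"
    and x: "x \<in> dist_sphere G (int i) v" "x \<in> dist_sphere G (int j) w"
    and y: "y \<in> dist_sphere G (int i) v" "y \<in> dist_sphere G (int j') w"
  shows "j' \<le> j"
proof -
  have "drop i v = take (D - i) x" "drop i v = take (D - i) y" and jx: "drop j w = take (D - j) x"
    using x y assms(2,3) by (auto intro!: walk_imp_overlap simp: mem_dist_sphere_iff[OF wf])
  then have "take (D - j) (take (D - i) x) = take (D - j) (take (D - i) y)"
    by simp
  then have "drop j w = take (D - j) y"
    using jx assms(2) by (simp add: min_def split: if_splits)
  moreover have "y \<in> pverts G"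
    using y by (simp add: dist_sphere_def)
  ultimately obtain m where "m \<le> j" "y \<in> walk_sphere G m w"
    using overlap_imp_walk assms(1,3) by metis
  then show ?thesis
    using y(2) by (fastforce simp: mem_dist_sphere_iff[OF wf])
qed

lemma sphere_intersection_unique:
  assumes "w \<in> pverts G" and "0 \<le> i"
    and "i \<le> j" "j \<le> int D" "dist_sphere G i v \<inter> dist_sphere G j w \<noteq> {}"
    and "i \<le> j'" "j' \<le> int D" "dist_sphere G i v \<inter> dist_sphere G j' w \<noteq> {}"
  shows "j = j'"
proof -
  obtain a b b' where "i = int a" "j = int b" "j' = int b'"
    using assms by (metis nonneg_int_cases order_trans)
  moreover obtain x y where "x \<in> dist_sphere G i v" "x \<in> dist_sphere G j w"
    "y \<in> dist_sphere G i v" "y \<in> dist_sphere G j' w"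
    using assms by blast
  ultimately show ?thesis
    using sphere_within_distance[of w a b x v y b'] sphere_within_distance[of w a b' y v x b] assms
    by auto
qed

text \<open>The lower bound \<open>i - 1\<close> is the triangle inequality, the upper bound \<open>D\<close> the diameter.\<close>

lemma sphere_distance_from_successor:
  assumes w: "w \<in> walk_sphere G 1 v" and u: "u \<in> dist_sphere G i v" and "0 \<le> i"
  obtains j where "i - 1 \<le> j" and "j \<le> int D" and "u \<in> dist_sphere G j w"
proof -
  obtain a where a: "i = int a"
    using assms(3) nonneg_int_cases by blast
  have "u \<in> pverts G"
    using u by (simp add: dist_sphere_def)
  obtain e where e: "e \<in> parcs G" "fst e = v" "snd e = w" "w \<in> pverts G"
    using w by (auto simp: walk_sphere_Suc_iff[OF wf] walk_sphere_0_iff)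
  obtain n where n: "n \<le> D" "u \<in> walk_sphere G n w"
    using walk_to_vertex \<open>u \<in> pverts G\<close> e(4) by blast
  obtain m where m: "m \<le> n" "u \<in> dist_sphere G (int m) w"
    using walk_sphere_imp_dist_sphere[OF wf n(2)] by blast
  have "u \<in> walk_sphere G (Suc m) v"
    using e m(2) by (auto simp: walk_sphere_Suc_iff[OF wf] mem_dist_sphere_iff[OF wf])
  then have "a \<le> Suc m"
    using u by (simp add: a mem_dist_sphere_iff[OF wf])
  then show ?thesis
    using that[of "int m"] m n(1) a by simp
qed

end

end

theorem proposition2:
  fixes A :: "'a set" and d D :: nat and i :: int
    and G :: "'a list pair_pre_digraph" and v :: "'a list"
  assumes "d \<ge> 2" and "D \<ge> 1"
    and "finite A"
    and "(card A = d \<and> G = de_bruijn A D) \<or> (card A = d + 1 \<and> G = kautz A D)"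
    and "v \<in> verts G"
    and "0 \<le> i" and "i \<le> int D"
  shows "(\<forall>w \<in> verts G. \<exists>\<^sub>\<le>\<^sub>1 j0::int. i \<le> j0 \<and> j0 \<le> int D \<and>
            dist_sphere G i v \<inter> dist_sphere G j0 w \<noteq> {}) \<and>
    (\<forall>w \<in> walk_sphere G 1 v.
      (\<exists>j0::int.
         (i \<le> j0 \<and> j0 \<le> int D \<and> dist_sphere G i v \<inter> dist_sphere G j0 w \<noteq> {}) \<and>
         (\<forall>j::int. i \<le> j \<and> j \<le> int D \<and> dist_sphere G i v \<inter> dist_sphere G j w \<noteq> {} \<longrightarrow> j = j0) \<and>
         (dist_sphere G i v \<inter> dist_sphere G (i - 1) w \<noteq> {} \<longrightarrow>
            dist_sphere G i v =
              (dist_sphere G i v \<inter> dist_sphere G (i - 1) w) \<union>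
              (dist_sphere G i v \<inter> dist_sphere G j0 w)) \<and>
         (dist_sphere G i v \<inter> dist_sphere G (i - 1) w = {} \<longrightarrow>
            dist_sphere G i v = dist_sphere G i v \<inter> dist_sphere G j0 w)) \<or>
      ((\<forall>j::int. i \<le> j \<and> j \<le> int D \<longrightarrow> dist_sphere G i v \<inter> dist_sphere G j w = {}) \<and>
       dist_sphere G i v = dist_sphere G i v \<inter> dist_sphere G (i - 1) w))"
proof -
  obtain R where G: "G = word_digraph R A D" and R: "\<forall>x y. R x y \<or> x = y"
    using assms(4) de_bruijn_eq_word_digraph kautz_eq_word_digraph by blast
  have wf: "wf_digraph G"
    using assms(2,4) wf_digraph_de_bruijn wf_digraph_kautz by blast
  note setting = wf[unfolded G] R assms(2)
  let ?S = "dist_sphere (with_proj G)"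
  have unique: "j = j'"
    if "w \<in> verts G" "i \<le> j" "j \<le> int D" "?S i v \<inter> ?S j w \<noteq> {}"
      "i \<le> j'" "j' \<le> int D" "?S i v \<inter> ?S j' w \<noteq> {}" for w j j'
    using sphere_intersection_unique[OF setting, of w i j v j'] that assms(6)
    unfolding G by simp
  have cover: "\<exists>j. (j = i - 1 \<or> i \<le> j) \<and> j \<le> int D \<and> u \<in> ?S j w"
    if w: "w \<in> walk_sphere G 1 v" and u: "u \<in> ?S i v" for w u
  proof -
    obtain j where "i - 1 \<le> j" "j \<le> int D" "u \<in> ?S j w"
      using sphere_distance_from_successor[OF setting w[unfolded G] u[unfolded G] assms(6)]
      unfolding G by blast
    then show ?thesis
      by (intro exI[of _ j]) auto
  qed
  have successor: "w \<in> verts G" if "w \<in> walk_sphere G 1 v" for w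
    using that by (auto simp: walk_sphere_Suc_iff[OF wf] walk_sphere_0_iff)
  show ?thesis
  proof (intro conjI ballI)
    fix w assume "w \<in> verts G"
    then show "\<exists>\<^sub>\<le>\<^sub>1 j0::int. i \<le> j0 \<and> j0 \<le> int D \<and> ?S i v \<inter> ?S j0 w \<noteq> {}"
      unfolding Uniq_def using unique by blast
  next
    fix w assume w: "w \<in> walk_sphere G 1 v"
    note unique = unique[OF successor[OF w]] and cover = cover[OF w]
    show "(\<exists>j0::int.
         (i \<le> j0 \<and> j0 \<le> int D \<and> ?S i v \<inter> ?S j0 w \<noteq> {}) \<and>
         (\<forall>j::int. i \<le> j \<and> j \<le> int D \<and> ?S i v \<inter> ?S j w \<noteq> {} \<longrightarrow> j = j0) \<and>
         (?S i v \<inter> ?S (i - 1) w \<noteq> {} \<longrightarrow> ?S i v = (?S i v \<inter> ?S (i - 1) w) \<union> (?S i v \<inter> ?S j0 w)) \<and>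
         (?S i v \<inter> ?S (i - 1) w = {} \<longrightarrow> ?S i v = ?S i v \<inter> ?S j0 w)) \<or>
      ((\<forall>j::int. i \<le> j \<and> j \<le> int D \<longrightarrow> ?S i v \<inter> ?S j w = {}) \<and>
       ?S i v = ?S i v \<inter> ?S (i - 1) w)"
    proof (cases "\<exists>j. i \<le> j \<and> j \<le> int D \<and> ?S i v \<inter> ?S j w \<noteq> {}")
      case True
      then obtain j0 where j0: "i \<le> j0" "j0 \<le> int D" "?S i v \<inter> ?S j0 w \<noteq> {}"
        by blast
      have only: "j = j0" if "i \<le> j" "j \<le> int D" "?S i v \<inter> ?S j w \<noteq> {}" for j
        using unique[OF that j0] .
      have "?S i v \<subseteq> ?S (i - 1) w \<union> ?S j0 w"
        using cover only by blast
      then show ?thesis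
        using j0 only by (intro disjI1 exI[of _ j0]) blast
    next
      case False
      then have "?S i v \<subseteq> ?S (i - 1) w"
        using cover by blast
      with False show ?thesis
        by blast
    qed
  qed
qed

end
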